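(* Let $X$ be a data domain and let $C$ be a class of predicates $c: X \to \{0,1\}$. Let $\alpha,\beta \in [0,1]$, $\varepsilon \ge 0$, $\delta \in [0,1]$ and $n$ a positive integer. Suppose $\mathcal{A}$ is an $(\alpha,\beta,\varepsilon,\delta,n)$-sanitizer for $C$ whose space complexity on inputs of size $n$ is $\mathrm{Space}(\mathcal{A},n)$, where $\mathrm{Space}(\mathcal{A},n)$ is at least linear in $n$. Let $m = k\cdot n$ for some positive integer $k$. Then there exists an $(\alpha, k\beta, \varepsilon, \delta, m)$-streaming-sanitizer for $C$ that uses space $\mathrm{Space}(\mathcal{A},n)$.
   Context: A dataset is a tuple $D \in X^n$; two datasets (or two streams) of the same length are neighboring if they differ in exactly one entry. A randomized algorithm $\mathcal{M}$ is $(\varepsilon,\delta)$-differentially private if for every pair of neighboring inputs $D, \hat D$ and every measurable set $T$ of outputs, $\Pr[\mathcal{M}(D)\in T] \le e^{\varepsilon}\Pr[\mathcal{M}(\hat D)\in T] + \delta$. An $(\alpha,\beta,\varepsilon,\delta,n)$-sanitizer for $C$ is an algorithm $\mathcal{A}$ that takes an input dataset $D \in X^n$ and outputs a dataset $D' \in X^n$ such that (1) $\mathcal{A}$ is $(\varepsilon,\delta)$-differentially private, and (2) for every $D \in X^n$ and every $c \in C$, with probability at least $1-\beta$ over the coins of $\mathcal{A}$, $\left|\frac{1}{|D|}\sum_{x\in D} c(x) - \frac{1}{|D'|}\sum_{x\in D'} c(x)\right| \le \alpha$ (sums are over entries with multiplicity). An $(\alpha,\beta,\varepsilon,\delta,m)$-streaming-sanitizer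 for $C$ is an algorithm that reads an input stream $S \in X^m$ item by item and outputs a stream $S' \in X^m$ such that (1) it is $(\varepsilon,\delta)$-differentially private (with respect to neighboring input streams of length $m$, the output being the entire output stream), and (2) for every $S \in X^m$ and every $c \in C$, with probability at least $1-\beta$ over its coins, at the end of the stream $\left|\frac{1}{|S|}\sum_{x\in S} c(x) - \frac{1}{|S'|}\sum_{x\in S'} c(x)\right| \le \alpha$. The space used by a streaming algorithm is the amount of memory it maintains while processing the stream. *)

theory Defs
  imports "HOL-Probability.Probability"
begin

section \<open>Datasets\<close>

text \<open>The data domain is a measurable space \<open>X\<close>; a discrete domain is
  \<open>count_space A\<close>. Datasets and streams are lists of entries.\<close>

definition datasets :: "'a measure \<Rightarrow> nat \<Rightarrow> 'a list set" where
  "datasets X n = {D. length D = n \<and> set D \<subseteq> space X}"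

text \<open>The product sigma-algebra, transported to lists of length \<open>n\<close>.\<close>

definition dataset_algebra :: "'a measure \<Rightarrow> nat \<Rightarrow> 'a list measure" where
  "dataset_algebra X n =
     vimage_algebra (datasets X n) (\<lambda>D. \<lambda>i\<in>{..<n}. D ! i) (PiM {..<n} (\<lambda>_. X))"

definition neighboring :: "'a list \<Rightarrow> 'a list \<Rightarrow> bool" where
  "neighboring D D' \<longleftrightarrow> length D = length D' \<and> card {i. i < length D \<and> D ! i \<noteq> D' ! i} = 1"

definition avg :: "('a \<Rightarrow> bool) \<Rightarrow> 'a list \<Rightarrow> real" where
  "avg c D = (\<Sum>x\<leftarrow>D. of_bool (c x)) / real (length D)"


section \<open>Randomized maps: privacy and accuracy\<close>

text \<open>A randomized map on \<open>X\<^sup>n\<close> is given by a probability space \<open>\<Omega>\<close> of coins, a predicate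
  \<open>hlt D \<omega>\<close> (the computation on \<open>D\<close> with coins \<open>\<omega>\<close> terminates) and the output \<open>res D \<omega>\<close>, which
  is meaningful only if the computation terminates.\<close>

definition outcome_event ::
  "'o measure \<Rightarrow> ('a list \<Rightarrow> 'o \<Rightarrow> bool) \<Rightarrow> ('a list \<Rightarrow> 'o \<Rightarrow> 'a list) \<Rightarrow> 'a list \<Rightarrow> 'a list set \<Rightarrow> 'o set"
  where "outcome_event \<Omega> hlt res D T = {\<omega> \<in> space \<Omega>. hlt D \<omega> \<and> res D \<omega> \<in> T}"

definition randomized_map ::
  "'a measure \<Rightarrow> nat \<Rightarrow> 'o measure \<Rightarrow> ('a list \<Rightarrow> 'o \<Rightarrow> bool) \<Rightarrow> ('a list \<Rightarrow> 'o \<Rightarrow> 'a list) \<Rightarrow> bool"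
  where "randomized_map X n \<Omega> hlt res \<longleftrightarrow>
    prob_space \<Omega> \<and>
    (\<forall>D \<in> datasets X n.
       (AE \<omega> in \<Omega>. hlt D \<omega>) \<and>
       (\<forall>\<omega> \<in> space \<Omega>. hlt D \<omega> \<longrightarrow> res D \<omega> \<in> datasets X n) \<and>
       (\<forall>T \<in> sets (dataset_algebra X n). outcome_event \<Omega> hlt res D T \<in> sets \<Omega>))"

definition differentially_private ::
  "'a measure \<Rightarrow> nat \<Rightarrow> real \<Rightarrow> real \<Rightarrow>
   'o measure \<Rightarrow> ('a list \<Rightarrow> 'o \<Rightarrow> bool) \<Rightarrow> ('a list \<Rightarrow> 'o \<Rightarrow> 'a list) \<Rightarrow> bool"
  where "differentially_private X n \<epsilon> \<delta> \<Omega> hlt res \<longleftrightarrow>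
    (\<forall>D \<in> datasets X n. \<forall>D' \<in> datasets X n. neighboring D D' \<longrightarrow>
       (\<forall>T \<in> sets (dataset_algebra X n).
          measure \<Omega> (outcome_event \<Omega> hlt res D T)
            \<le> exp \<epsilon> * measure \<Omega> (outcome_event \<Omega> hlt res D' T) + \<delta>))"

definition accurate ::
  "'a measure \<Rightarrow> ('a \<Rightarrow> bool) set \<Rightarrow> nat \<Rightarrow> real \<Rightarrow> real \<Rightarrow>
   'o measure \<Rightarrow> ('a list \<Rightarrow> 'o \<Rightarrow> bool) \<Rightarrow> ('a list \<Rightarrow> 'o \<Rightarrow> 'a list) \<Rightarrow> bool"
  where "accurate X C n \<alpha> \<beta> \<Omega> hlt res \<longleftrightarrow>
    (\<forall>D \<in> datasets X n. \<forall>c \<in> C.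
       measure \<Omega> (outcome_event \<Omega> hlt res D {D' \<in> datasets X n. \<bar>avg c D - avg c D'\<bar> \<le> \<alpha>})
         \<ge> 1 - \<beta>)"


section \<open>Randomized machines\<close>

text \<open>A memory is a list of cells, each of which holds one data item or one machine word.
  Space is the number of cells. The word type is a parameter; algorithms are compared only over
  the same word type, so the capacity of a cell cannot be changed from one to the other.\<close>

datatype ('a, 'w) cell = Item 'a | Word 'w

text \<open>A transition consumes one fresh coin, an independent sample from \<open>coins\<close>, and may append
  one item to the write-only output. The control state \<open>'q\<close> is the program counter, which is
  not charged as space; it is to be instantiated with finite types.\<close>

record ('r, 'q, 'a, 'w) machine =
  coins :: "'r measure"
  start :: 'q
  final :: "'q set"
  trans :: "'r \<Rightarrow> 'q \<times> ('a, 'w) cell list \<Rightarrow> ('q \<times> ('a, 'w) cell list) \<times> 'a option"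

text \<open>The configuration after \<open>t\<close> transitions from the initial memory \<open>mem\<close>, with the output
  emitted so far. Final configurations are repeated forever.\<close>

primrec run ::
  "('r, 'q, 'a, 'w, 'z) machine_scheme \<Rightarrow> (nat \<Rightarrow> 'r) \<Rightarrow> ('a, 'w) cell list \<Rightarrow> nat
    \<Rightarrow> ('q \<times> ('a, 'w) cell list) \<times> 'a list"
  where
    "run A \<omega> mem 0 = ((start A, mem), [])"
  | "run A \<omega> mem (Suc t) =
       (let (cfg, ys) = run A \<omega> mem t in
        if fst cfg \<in> final A then (cfg, ys)
        else let (cfg', y) = trans A (\<omega> t) cfg
             in (cfg', ys @ (case y of None \<Rightarrow> [] | Some x \<Rightarrow> [x])))"

definition final_at ::
  "('r, 'q, 'a, 'w, 'z) machine_scheme \<Rightarrow> (nat \<Rightarrow> 'r) \<Rightarrow> ('a, 'w) cell list \<Rightarrow> nat \<Rightarrow> bool"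
  where "final_at A \<omega> mem t \<longleftrightarrow> fst (fst (run A \<omega> mem t)) \<in> final A"

definition halts ::
  "('r, 'q, 'a, 'w, 'z) machine_scheme \<Rightarrow> (nat \<Rightarrow> 'r) \<Rightarrow> ('a, 'w) cell list \<Rightarrow> bool"
  where "halts A \<omega> mem \<longleftrightarrow> (\<exists>t. final_at A \<omega> mem t)"

definition mem_at ::
  "('r, 'q, 'a, 'w, 'z) machine_scheme \<Rightarrow> (nat \<Rightarrow> 'r) \<Rightarrow> ('a, 'w) cell list \<Rightarrow> nat
    \<Rightarrow> ('a, 'w) cell list"
  where "mem_at A \<omega> mem t = snd (fst (run A \<omega> mem t))"

text \<open>Final memory and output; meaningful only if the run halts.\<close>

definition run_result ::
  "('r, 'q, 'a, 'w, 'z) machine_scheme \<Rightarrow> (nat \<Rightarrow> 'r) \<Rightarrow> ('a, 'w) cell list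
    \<Rightarrow> ('a, 'w) cell list \<times> 'a list"
  where "run_result A \<omega> mem =
    (let t = (LEAST t. final_at A \<omega> mem t) in (mem_at A \<omega> mem t, snd (run A \<omega> mem t)))"

definition tape :: "('r, 'q, 'a, 'w, 'z) machine_scheme \<Rightarrow> (nat \<Rightarrow> 'r) measure" where
  "tape A = PiM UNIV (\<lambda>_. coins A)"


section \<open>Sanitizers\<close>

text \<open>An offline algorithm is run once. Its initial memory \<open>layout D\<close> is its own representation
  of the input dataset, which need not spend one cell per entry (several entries may be packed
  into a word); hence its space is not automatically at least the input size.\<close>

record ('r, 'q, 'a, 'w) offline = "('r, 'q, 'a, 'w) machine" +
  layout :: "'a list \<Rightarrow> ('a, 'w) cell list"

definition sanitizer ::
  "'a measure \<Rightarrow> ('a \<Rightarrow> bool) set \<Rightarrow> real \<Rightarrow> real \<Rightarrow> real \<Rightarrow> real \<Rightarrow> nat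
    \<Rightarrow> ('r, 'q, 'a, 'w) offline \<Rightarrow> bool"
  where "sanitizer X C \<alpha> \<beta> \<epsilon> \<delta> n A \<longleftrightarrow>
    (let \<Omega> = tape A;
         hlt = (\<lambda>D \<omega>. halts A \<omega> (layout A D));
         res = (\<lambda>D \<omega>. snd (run_result A \<omega> (layout A D)))
     in prob_space (coins A) \<and> randomized_map X n \<Omega> hlt res \<and>
        differentially_private X n \<epsilon> \<delta> \<Omega> hlt res \<and> accurate X C n \<alpha> \<beta> \<Omega> hlt res)"

text \<open>Worst-case number of cells over all inputs of size \<open>n\<close>, all coins and all times.\<close>

definition offline_space :: "'a measure \<Rightarrow> ('r, 'q, 'a, 'w) offline \<Rightarrow> nat \<Rightarrow> ennreal" where
  "offline_space X A n =
     (SUP D \<in> datasets X n. SUP \<omega> \<in> space (tape A). SUP t.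
        of_nat (length (mem_at A \<omega> (layout A D) t)))"


section \<open>Streaming sanitizers\<close>

text \<open>A streaming algorithm is a machine that starts with empty memory and is invoked once per
  arriving item: the item is appended to the memory as one cell, the control is reset to
  \<open>start\<close>, and the machine runs until it halts and waits for the next item. Because of the
  reset, information passes from one item to the next only through the memory.
  The \<open>t\<close>-th transition after arrival \<open>i\<close> uses the coin \<open>\<omega> i t\<close>; all coins are independent.
  \<open>online_run B \<omega> S i\<close> is the memory and the output emitted before arrival \<open>i\<close>.\<close>

primrec online_run ::
  "('r, 'q, 'a, 'w) machine \<Rightarrow> (nat \<Rightarrow> nat \<Rightarrow> 'r) \<Rightarrow> 'a list \<Rightarrow> nat
    \<Rightarrow> ('a, 'w) cell list \<times> 'a list"
  where
    "online_run B \<omega> S 0 = ([], [])"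
  | "online_run B \<omega> S (Suc i) =
       (let (mem, ys) = online_run B \<omega> S i;
            (mem', ys') = run_result B (\<omega> i) (mem @ [Item (S ! i)])
        in (mem', ys @ ys'))"

definition arrival_mem ::
  "('r, 'q, 'a, 'w) machine \<Rightarrow> (nat \<Rightarrow> nat \<Rightarrow> 'r) \<Rightarrow> 'a list \<Rightarrow> nat \<Rightarrow> ('a, 'w) cell list"
  where "arrival_mem B \<omega> S i = fst (online_run B \<omega> S i) @ [Item (S ! i)]"

definition online_halts ::
  "('r, 'q, 'a, 'w) machine \<Rightarrow> (nat \<Rightarrow> nat \<Rightarrow> 'r) \<Rightarrow> 'a list \<Rightarrow> nat \<Rightarrow> bool"
  where "online_halts B \<omega> S i \<longleftrightarrow> (\<forall>j<i. halts B (\<omega> j) (arrival_mem B \<omega> S j))"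

definition online_tape :: "('r, 'q, 'a, 'w) machine \<Rightarrow> nat \<Rightarrow> (nat \<Rightarrow> nat \<Rightarrow> 'r) measure" where
  "online_tape B m = PiM {..<m} (\<lambda>_. tape B)"

definition streaming_sanitizer ::
  "'a measure \<Rightarrow> ('a \<Rightarrow> bool) set \<Rightarrow> real \<Rightarrow> real \<Rightarrow> real \<Rightarrow> real \<Rightarrow> nat
    \<Rightarrow> ('r, 'q, 'a, 'w) machine \<Rightarrow> bool"
  where "streaming_sanitizer X C \<alpha> \<beta> \<epsilon> \<delta> m B \<longleftrightarrow>
    (let \<Omega> = online_tape B m;
         hlt = (\<lambda>S \<omega>. online_halts B \<omega> S m);
         res = (\<lambda>S \<omega>. snd (online_run B \<omega> S m))
     in prob_space (coins B) \<and> randomized_map X m \<Omega> hlt res \<and>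
        differentially_private X m \<epsilon> \<delta> \<Omega> hlt res \<and> accurate X C m \<alpha> \<beta> \<Omega> hlt res)"

text \<open>Worst-case number of cells over all streams of length \<open>m\<close>, all coins, all arrivals that
  actually take place, and all times during the processing of an arrival.\<close>

definition streaming_space :: "'a measure \<Rightarrow> ('r, 'q, 'a, 'w) machine \<Rightarrow> nat \<Rightarrow> ennreal" where
  "streaming_space X B m =
     (SUP S \<in> datasets X m. SUP \<omega> \<in> space (online_tape B m).
        SUP i \<in> {i. i < m \<and> online_halts B \<omega> S i}. SUP t.
          of_nat (length (mem_at B (\<omega> i) (arrival_mem B \<omega> S i) t)))"

end

theory Submission
  imports Defs
begin

text \<open>
  Cut the stream into \<open>k\<close> blocks of \<open>n\<close> items, buffer each block, run \<open>A\<close> on it with fresh coins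
  as soon as it is complete, and then empty the memory. Neighboring streams differ in a single
  block, so after fixing the coins of all other blocks the privacy inequality is that of one run
  of \<open>A\<close>, applied to a section of the event; integrating over the other coins costs nothing,
  neither in \<open>\<epsilon>\<close> nor in \<open>\<delta>\<close>. The average over the stream is the mean of the block averages, so it
  is accurate if every block is, and the union bound over the blocks gives \<open>k\<beta>\<close>. The buffer has at
  most \<open>n\<close> cells, which is where the linear lower bound on the space of \<open>A\<close> enters.
\<close>

section \<open>Blocks of a stream\<close>

definition block :: "nat \<Rightarrow> 'a list \<Rightarrow> nat \<Rightarrow> 'a list" where
  "block n S b = take n (drop (b * n) S)"

lemma block_index_less: "b < k \<Longrightarrow> i < n \<Longrightarrow> b * n + i < k * (n::nat)"
  by (metis add_less_cancel_left less_le_trans mult_Suc mult_le_mono1 Suc_leI add.commute)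

lemma length_block: "length S = k * n \<Longrightarrow> b < k \<Longrightarrow> length (block n S b) = n"
proof -
  assume "length S = k * n" "b < k"
  moreover have "Suc b * n \<le> k * n" using \<open>b < k\<close> by (intro mult_le_mono1) simp
  ultimately show ?thesis by (simp add: block_def)
qed

lemma nth_block:
  "length S = k * n \<Longrightarrow> b < k \<Longrightarrow> i < n \<Longrightarrow> block n S b ! i = S ! (b * n + i)"
  using block_index_less[of b k i n] by (simp add: block_def)

lemma block_in_datasets: "S \<in> datasets X (k * n) \<Longrightarrow> b < k \<Longrightarrow> block n S b \<in> datasets X n"
  using length_block[of S k n b] unfolding datasets_def
  by (auto simp: block_def dest!: in_set_takeD in_set_dropD)

lemma concat_blocks: "length S = k * n \<Longrightarrow> concat (map (block n S) [0..<k]) = S"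
proof -
  \<comment> \<open>The induction on \<open>j\<close> needs no length condition: past the end of
    \<open>S\<close> both sides are truncated alike.\<close>
  have "concat (map (block n S) [0..<j]) = take (j * n) S" for j
    by (induction j) (simp_all add: block_def take_add add.commute[of n])
  then show "length S = k * n \<Longrightarrow> ?thesis" by simp
qed

lemma length_concat_uniform:
  "(\<And>b. b < k \<Longrightarrow> length (F b) = n) \<Longrightarrow> length (concat (map F [0..<k])) = k * n"
  by (induction k) auto

text \<open>Lets measurability of a concatenation be tested coordinate by coordinate, since each
  coordinate comes from a single block.\<close>

lemma nth_concat_uniform:
  assumes "\<And>b. b < k \<Longrightarrow> length (F b) = n" and "i < k * n"
  shows "concat (map F [0..<k]) ! i = F (i div n) ! (i mod n)"
  using assms
proof (induction k)
  case (Suc k)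
  have len: "length (concat (map F [0..<k])) = k * n"
    using Suc.prems by (intro length_concat_uniform) auto
  show ?case
  proof (cases "i < k * n")
    case True
    then show ?thesis using Suc len by (simp add: nth_append)
  next
    case False
    with Suc.prems have "i div n = k" by (intro div_nat_eqI) (auto simp: mult.commute)
    moreover from this have "i - k * n = i mod n"
      by (metis minus_div_mult_eq_mod)
    ultimately show ?thesis using False len by (simp add: nth_append)
  qed
qed simp

lemma concat_in_datasets:
  assumes "\<And>b. b < k \<Longrightarrow> F b \<in> datasets X n"
  shows "concat (map F [0..<k]) \<in> datasets X (k * n)"
  using assms length_concat_uniform[of k F n] by (fastforce simp: datasets_def)

text \<open>Division with remainder places the one differing position \<open>j\<close> in block
  \<open>j div n\<close> at offset \<open>j mod n\<close>, and in no other block.\<close>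

lemma neighboring_blocks:
  assumes "neighboring S S'" and len: "length S = k * n"
  obtains b where "b < k" and "neighboring (block n S b) (block n S' b)"
    and "\<And>b'. b' < k \<Longrightarrow> b' \<noteq> b \<Longrightarrow> block n S b' = block n S' b'"
proof -
  have len': "length S' = k * n" using assms by (simp add: neighboring_def)
  obtain j where "{i. i < length S \<and> S ! i \<noteq> S' ! i} = {j}"
    using assms(1) by (auto simp: neighboring_def card_1_singleton_iff)
  then have j: "i < k * n \<and> S ! i \<noteq> S' ! i \<longleftrightarrow> i = j" for i
    using len by (simp add: set_eq_iff)
  have jk: "j < k * n" using j by blast
  then have n: "n > 0" by (cases n) auto
  define b where "b = j div n"
  have b: "b < k" using jk by (simp add: b_def less_mult_imp_div_less)
  have eq: "b' * n + i = j \<longleftrightarrow> b' = b \<and> i = j mod n" if "i < n" for b' i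
    using that by (auto simp: b_def)
  have diff: "block n S b' ! i \<noteq> block n S' b' ! i \<longleftrightarrow> b' = b \<and> i = j mod n"
    if "b' < k" "i < n" for b' i
    using j[of "b' * n + i"] that block_index_less[OF that]
    by (simp add: nth_block[OF len] nth_block[OF len'] eq)
  show thesis
  proof (rule that[OF b])
    have "{i. i < n \<and> block n S b ! i \<noteq> block n S' b ! i} = {j mod n}"
      using diff[OF b] mod_less_divisor[OF n] by blast
    then show "neighboring (block n S b) (block n S' b)"
      using b by (simp add: neighboring_def length_block[OF len] length_block[OF len'])
    show "block n S b' = block n S' b'" if "b' < k" "b' \<noteq> b" for b'
      using diff[OF that(1)] that
      by (intro nth_equalityI) (auto simp: length_block[OF len] length_block[OF len'])
  qed
qed

lemma avg_concat_uniform: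
  assumes "\<And>b. b < k \<Longrightarrow> length (F b) = n" and "n > 0"
  shows "avg c (concat (map F [0..<k])) = (\<Sum>b<k. avg c (F b)) / real k"
proof -
  have "(\<Sum>x\<leftarrow>concat (map F [0..<k]). of_bool (c x)) = (\<Sum>b<k. \<Sum>x\<leftarrow>F b. of_bool (c x) :: real)"
    by (induction k) auto
  moreover have "(\<Sum>b<k. avg c (F b)) = (\<Sum>b<k. \<Sum>x\<leftarrow>F b. of_bool (c x)) / real n"
    using assms by (simp add: avg_def sum_divide_distrib)
  ultimately show ?thesis
    using length_concat_uniform[of k F n] assms by (simp add: avg_def mult.commute)
qed

text \<open>Triangle inequality for the mean of the block errors; averaging absorbs the factor
  \<open>k\<close> that the sum of the errors carries.\<close>

lemma avg_concat_close:
  assumes "\<And>b. b < k \<Longrightarrow> length (F b) = n" and "\<And>b. b < k \<Longrightarrow> length (G b) = n"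
    and "n > 0" and "k > 0" and close: "\<And>b. b < k \<Longrightarrow> \<bar>avg c (F b) - avg c (G b)\<bar> \<le> \<alpha>"
  shows "\<bar>avg c (concat (map F [0..<k])) - avg c (concat (map G [0..<k]))\<bar> \<le> \<alpha>"
proof -
  have "\<bar>\<Sum>b<k. avg c (F b) - avg c (G b)\<bar> \<le> (\<Sum>b<k. \<bar>avg c (F b) - avg c (G b)\<bar>)"
    by (rule sum_abs)
  also have "\<dots> \<le> real k * \<alpha>"
    using sum_bounded_above[of "{..<k}" "\<lambda>b. \<bar>avg c (F b) - avg c (G b)\<bar>" \<alpha>] close by simp
  finally show ?thesis
    using \<open>k > 0\<close> assms
    by (simp add: avg_concat_uniform[of k _ n] diff_divide_distrib[symmetric] sum_subtractf
        pos_divide_le_eq mult.commute)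
qed


section \<open>The streaming machine\<close>

text \<open>Left inverse of \<open>Item\<close>; the value on a \<open>Word\<close> is arbitrary, as
  the buffer holds only \<open>Item\<close> cells.\<close>

definition item :: "('a, 'w) cell \<Rightarrow> 'a" where
  "item x = (case x of Item a \<Rightarrow> a | Word _ \<Rightarrow> undefined)"

text \<open>\<open>Some\<close> keeps the control states of \<open>A\<close> apart from the fresh
  start state \<open>None\<close>, which marks the arrival of an item. Clearing lets the next block
  start with an empty buffer.\<close>

definition final_clearing_step ::
  "('r, 'q, 'a, 'w) offline \<Rightarrow> 'r \<Rightarrow> 'q \<times> ('a, 'w) cell list
    \<Rightarrow> ('q option \<times> ('a, 'w) cell list) \<times> 'a option"
  where "final_clearing_step A r cfg =
    (let ((q, mem), y) = trans A r cfg in ((Some q, if q \<in> final A then [] else mem), y))"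

text \<open>The first transition on a full buffer already performs the first step of \<open>A\<close>, and the
  transition that makes \<open>A\<close> final also empties the memory. Thus the \<open>t\<close>-th coin is used as \<open>A\<close>
  would use it, and a full buffer is processed with exactly the coins of one run of \<open>A\<close>.\<close>

definition stream_machine ::
  "nat \<Rightarrow> ('r, 'q, 'a, 'w) offline \<Rightarrow> ('r, 'q option, 'a, 'w) machine"
  where "stream_machine n A =
    \<lparr>coins = coins A, start = None, final = Some ` final A,
     trans = (\<lambda>r (s, mem). case s of
         None \<Rightarrow>
           if length mem < n then ((Some (SOME q. q \<in> final A), mem), None)
           else final_clearing_step A r (start A, layout A (map item mem))
       | Some q \<Rightarrow> final_clearing_step A r (q, mem))\<rparr>"

lemma stream_machine_simps [simp]:
  "coins (stream_machine n A) = coins A"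
  "start (stream_machine n A) = None"
  "final (stream_machine n A) = Some ` final A"
  "trans (stream_machine n A) r (None, mem) =
     (if length mem < n then ((Some (SOME q. q \<in> final A), mem), None)
      else final_clearing_step A r (start A, layout A (map item mem)))"
  "trans (stream_machine n A) r (Some q, mem) = final_clearing_step A r (q, mem)"
  by (simp_all add: stream_machine_def)

lemma tape_stream_machine [simp]: "tape (stream_machine n A) = tape A"
  by (simp add: tape_def)

section \<open>Invocations that only store an item\<close>

lemma run_buffering:
  assumes "length mem < n" and "final A \<noteq> {}"
  shows "run (stream_machine n A) \<omega> mem (Suc t) = ((Some (SOME q. q \<in> final A), mem), [])"
proof (induction t)
  case 0
  show ?case using assms by auto
next
  case (Suc t)
  \<comment> \<open>\<open>SOME\<close> yields a genuine final state because \<open>final A\<close>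
    is nonempty, so the configuration repeats from time 1 on.\<close>
  have "(SOME q. q \<in> final A) \<in> final A" using assms(2) by (simp add: some_in_eq)
  then show ?case using Suc.IH by (subst run.simps(2)) simp
qed

lemma mem_at_buffering:
  assumes "length mem < n" and "final A \<noteq> {}"
  shows "mem_at (stream_machine n A) \<omega> mem t = mem"
  using run_buffering[OF assms] by (cases t) (simp_all add: mem_at_def)

lemma final_at_buffering:
  assumes "length mem < n" and "final A \<noteq> {}"
  shows "final_at (stream_machine n A) \<omega> mem t \<longleftrightarrow> t > 0"
  using run_buffering[OF assms] assms(2)
  by (cases t) (simp_all add: final_at_def some_in_eq image_iff)

lemma halts_buffering:
  "length mem < n \<Longrightarrow> final A \<noteq> {} \<Longrightarrow> halts (stream_machine n A) \<omega> mem"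
  unfolding halts_def using final_at_buffering[of mem n A \<omega> 1] by auto

lemma run_result_buffering:
  assumes "length mem < n" and "final A \<noteq> {}"
  shows "run_result (stream_machine n A) \<omega> mem = (mem, [])"
proof -
  \<comment> \<open>The control starts in \<open>None\<close>, which is never final, so the halting
    time is 1 and not 0.\<close>
  have "(LEAST t. t > 0) = Suc 0" by (rule Least_equality) auto
  then show ?thesis
    using run_buffering[OF assms, of \<omega> 0]
    by (simp add: run_result_def final_at_buffering[OF assms] mem_at_buffering[OF assms]
        del: run.simps)
qed

section \<open>Invocations on a full buffer\<close>

text \<open>Lockstep simulation with equal coins. It is stated from time 1 on because at time 0 the
  memory is still the raw buffer and the control is \<open>None\<close>. If \<open>A\<close> started
  in a final state, it would make no step and the two runs would part.\<close>

lemma run_full: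
  assumes "length D = n" and "start A \<notin> final A"
  shows "run (stream_machine n A) \<omega> (map Item D) (Suc t) =
    (let ((q, mem), ys) = run A \<omega> (layout A D) (Suc t)
     in ((Some q, if q \<in> final A then [] else mem), ys))"
proof (induction t)
  case 0
  show ?case
    using assms by (auto simp: final_clearing_step_def Let_def item_def comp_def split: prod.splits)
next
  case (Suc t)
  obtain q mem ys where A: "run A \<omega> (layout A D) (Suc t) = ((q, mem), ys)"
    by (metis prod.exhaust)
  show ?case
    using Suc.IH unfolding A run.simps(2)[of _ _ _ "Suc t"]
    by (auto simp: final_clearing_step_def Let_def image_iff split: prod.splits)
qed

lemma final_at_full:
  assumes "length D = n" and "start A \<notin> final A"
  shows "final_at (stream_machine n A) \<omega> (map Item D) t \<longleftrightarrow> final_at A \<omega> (layout A D) t"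
proof (cases t)
  case 0
  then show ?thesis using assms by (simp add: final_at_def image_iff)
next
  case (Suc t')
  then show ?thesis
    using run_full[OF assms, of \<omega> t']
    by (auto simp: final_at_def image_iff Let_def simp del: run.simps split: prod.splits)
qed

lemma halts_full:
  assumes "length D = n" and "start A \<notin> final A"
  shows "halts (stream_machine n A) \<omega> (map Item D) \<longleftrightarrow> halts A \<omega> (layout A D)"
  by (simp add: halts_def final_at_full[OF assms])

text \<open>The bound \<open>n\<close> accounts for time 0, when the raw buffer is present; later
  the memory is that of \<open>A\<close> or empty.\<close>

lemma length_mem_at_full:
  assumes "length D = n" and "start A \<notin> final A"
  shows "length (mem_at (stream_machine n A) \<omega> (map Item D) t)
    \<le> max n (length (mem_at A \<omega> (layout A D) t))"
proof (cases t)
  case 0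
  then show ?thesis using assms by (simp add: mem_at_def)
next
  case (Suc t')
  then show ?thesis
    using run_full[OF assms, of \<omega> t']
    by (auto simp: mem_at_def Let_def simp del: run.simps split: prod.splits)
qed

lemma run_result_full:
  assumes "length D = n" and "start A \<notin> final A" and "halts A \<omega> (layout A D)"
  shows "run_result (stream_machine n A) \<omega> (map Item D) =
    ([], snd (run_result A \<omega> (layout A D)))"
proof -
  define t where "t = (LEAST t. final_at A \<omega> (layout A D) t)"
  have fin: "final_at A \<omega> (layout A D) t"
    using assms(3) unfolding t_def halts_def by (metis LeastI)
  \<comment> \<open>As \<open>start A\<close> is not final, the halting time is positive, so
    \<open>run_full\<close> applies to it.\<close>
  then obtain t' where t': "t = Suc t'"
    using assms(2) by (cases t) (auto simp: final_at_def)
  have "run_result (stream_machine n A) \<omega> (map Item D) =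
      (mem_at (stream_machine n A) \<omega> (map Item D) t, snd (run (stream_machine n A) \<omega> (map Item D) t))"
    by (simp add: run_result_def final_at_full[OF assms(1,2)] t_def Let_def)
  moreover have "snd (run_result A \<omega> (layout A D)) = snd (run A \<omega> (layout A D) t)"
    by (simp add: run_result_def t_def Let_def)
  ultimately show ?thesis
    using run_full[OF assms(1,2), of \<omega> t'] fin
    by (auto simp: t' mem_at_def final_at_def Let_def simp del: run.simps split: prod.splits)
qed

text \<open>Both conjuncts go into one induction because whether the next invocation halts depends on the
  memory, which in turn is only known as long as all earlier invocations have halted.\<close>

lemma online_stream_machine:
  fixes A :: "('r, 'q, 'a, 'w) offline"
  assumes n: "n > 0" and fin: "final A \<noteq> {}" "start A \<notin> final A"
    and len: "length S = k * n" and "i \<le> k * n"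
  shows "(online_halts (stream_machine n A) \<omega> S i \<longleftrightarrow>
      (\<forall>b<i div n. halts A (\<omega> (b * n + (n - 1))) (layout A (block n S b)))) \<and>
    (online_halts (stream_machine n A) \<omega> S i \<longrightarrow>
      online_run (stream_machine n A) \<omega> S i =
        (map Item (take (i mod n) (drop (i div n * n) S)),
         concat (map (\<lambda>b. snd (run_result A (\<omega> (b * n + (n - 1))) (layout A (block n S b))))
           [0..<i div n])))"
  (is "(?H i \<longleftrightarrow> ?H' i) \<and> (?H i \<longrightarrow> ?R i)")
  using \<open>i \<le> k * n\<close>
proof (induction i)
  case 0
  show ?case by (simp add: online_halts_def)
next
  case (Suc i)
  let ?B = "stream_machine n A"
  have IH: "?H i \<longleftrightarrow> ?H' i" "?H i \<Longrightarrow> ?R i" using Suc by auto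
  have i: "i < k * n" using Suc.prems by simp
  have H: "?H (Suc i) \<longleftrightarrow> ?H i \<and> halts ?B (\<omega> i) (arrival_mem ?B \<omega> S i)"
    by (auto simp: online_halts_def less_Suc_eq)
  \<comment> \<open>The part of the current block seen so far, the item of arrival \<open>i\<close>
    included; arrivals count from 0.\<close>
  define D where "D = take (Suc (i mod n)) (drop (i div n * n) S)"
  have rest: "i mod n < length (drop (i div n * n) S)" "drop (i div n * n) S ! (i mod n) = S ! i"
  proof -
    have "i div n * n + i mod n < length S" using i len by simp
    then have "i div n * n \<le> length S" by (rule order.trans[OF le_add1 less_imp_le])
    then show "drop (i div n * n) S ! (i mod n) = S ! i"
      by (simp only: nth_drop div_mult_mod_eq)
    show "i mod n < length (drop (i div n * n) S)"
      using \<open>i div n * n + i mod n < length S\<close>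
      by (simp only: length_drop less_diff_conv add.commute)
  qed
  have arr: "arrival_mem ?B \<omega> S i = map Item D" if "?H i"
  proof -
    have "arrival_mem ?B \<omega> S i = map Item (take (i mod n) (drop (i div n * n) S) @ [S ! i])"
      using IH(2)[OF that] by (simp add: arrival_mem_def)
    also have "take (i mod n) (drop (i div n * n) S) @ [S ! i] = D"
      unfolding D_def take_Suc_conv_app_nth[OF rest(1)] rest(2) ..
    finally show ?thesis .
  qed
  have lenD: "length D = Suc (i mod n)"
    using rest(1) by (simp add: D_def)
  have run: "online_run ?B \<omega> S (Suc i) =
    (fst (run_result ?B (\<omega> i) (map Item D)),
     snd (online_run ?B \<omega> S i) @ snd (run_result ?B (\<omega> i) (map Item D)))" if "?H i"
    using arr[OF that] by (auto simp: arrival_mem_def Let_def case_prod_unfold)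
  show ?case
  \<comment> \<open>Arrival \<open>i\<close> completes a block exactly when \<open>n\<close> divides
    \<open>Suc i\<close>; otherwise its item is only stored.\<close>
  proof (cases "Suc i mod n = 0")
    case False
    then have m: "Suc i mod n = Suc (i mod n)" "Suc i div n = i div n"
      by (auto simp: mod_Suc div_Suc split: if_splits)
    then have lt: "length (map Item D :: ('a, 'w) cell list) < n"
      using n lenD by (metis length_map mod_less_divisor)
    have "?H (Suc i) \<longleftrightarrow> ?H i"
      using H arr halts_buffering[where ?A = A, OF lt fin(1)] by metis
    moreover have "?R (Suc i)" if "?H i"
      using run[OF that] IH(2)[OF that] run_result_buffering[where ?A = A, OF lt fin(1)]
      by (simp only: m D_def fst_conv snd_conv append_Nil2)
    ultimately show ?thesis
      using IH(1) by (auto simp only: m)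
  next
    case True
    then have m: "Suc (i mod n) = n" "Suc i div n = Suc (i div n)"
      by (auto simp: mod_Suc div_Suc split: if_splits)
    then have D: "D = block n S (i div n)" "length D = n"
      using lenD by (simp_all only: D_def block_def)
    \<comment> \<open>The current arrival is the last one of its block, so the coins that the claim
      assigns to this block are \<open>\<omega> i\<close>.\<close>
    have ieq: "i div n * n + (n - 1) = i" using m(1) by (metis diff_Suc_1 div_mult_mod_eq)
    have "?H (Suc i) \<longleftrightarrow> ?H i \<and> halts A (\<omega> i) (layout A D)"
      using H arr halts_full[OF D(2) fin(2)] by metis
    moreover have "?H' (Suc i) \<longleftrightarrow> ?H' i \<and> halts A (\<omega> i) (layout A D)"
      by (auto simp only: m(2) less_Suc_eq ieq D(1))
    moreover have "?R (Suc i)" if "?H i" "halts A (\<omega> i) (layout A D)"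
      using run[OF that(1)] IH(2)[OF that(1)] run_result_full[OF D(2) fin(2) that(2)] ieq
      by (simp only: m True D(1) fst_conv snd_conv) simp
    ultimately show ?thesis
      using IH(1) by blast
  qed
qed


section \<open>Measurability of datasets\<close>

lemma space_dataset_algebra [simp]: "space (dataset_algebra X n) = datasets X n"
  by (simp add: dataset_algebra_def)

lemma measurable_nth_dataset:
  assumes "i < n"
  shows "(\<lambda>D. D ! i) \<in> measurable (dataset_algebra X n) X"
proof -
  have "(\<lambda>D. \<lambda>i\<in>{..<n}. D ! i) \<in> measurable (dataset_algebra X n) (PiM {..<n} (\<lambda>_. X))"
    unfolding dataset_algebra_def
    by (rule measurable_vimage_algebra1)
      (auto simp: datasets_def space_PiM intro!: restrict_PiE_iff[THEN iffD2])
  from measurable_compose[OF this measurable_component_singleton[of i]] assms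
  show ?thesis by simp
qed

text \<open>The sigma-algebra on lists is pulled back from a product, so it inherits the universal
  property of the product.\<close>

lemma measurable_datasetI:
  assumes "\<And>x. x \<in> space N \<Longrightarrow> f x \<in> datasets X n"
    and "\<And>i. i < n \<Longrightarrow> (\<lambda>x. f x ! i) \<in> measurable N X"
  shows "f \<in> measurable N (dataset_algebra X n)"
  unfolding dataset_algebra_def
  using assms by (intro measurable_vimage_algebra2 measurable_restrict) auto

lemma measurable_concat_dataset:
  assumes F: "\<And>b. b < k \<Longrightarrow> (\<lambda>x. F x b) \<in> measurable N (dataset_algebra X n)"
  shows "(\<lambda>x. concat (map (F x) [0..<k])) \<in> measurable N (dataset_algebra X (k * n))"
proof (rule measurable_datasetI)
  have mem: "F x b \<in> datasets X n" if "x \<in> space N" "b < k" for x b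
    using measurable_space[OF F[OF that(2)] that(1)] by simp
  then show "concat (map (F x) [0..<k]) \<in> datasets X (k * n)" if "x \<in> space N" for x
    using that by (intro concat_in_datasets)
  fix i assume i: "i < k * n"
  then have "i div n < k" "i mod n < n"
    by (simp_all add: less_mult_imp_div_less) (cases n; simp)
  then have "(\<lambda>x. F x (i div n) ! (i mod n)) \<in> measurable N X"
    using measurable_compose[OF F measurable_nth_dataset] by blast
  \<comment> \<open>The blocks are known to have length \<open>n\<close> only for \<open>x\<close>
    in \<open>space N\<close>, which suffices for measurability.\<close>
  moreover have "concat (map (F x) [0..<k]) ! i = F x (i div n) ! (i mod n)" if "x \<in> space N" for x
    using mem[OF that] i by (intro nth_concat_uniform) (auto simp: datasets_def)
  ultimately show "(\<lambda>x. concat (map (F x) [0..<k]) ! i) \<in> measurable N X"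
    by (simp cong: measurable_cong)
qed

lemma measurable_avg:
  assumes "c \<in> measurable X (count_space UNIV)"
  shows "avg c \<in> borel_measurable (dataset_algebra X n)"
proof -
  have "(\<lambda>D. of_bool (c (D ! i)) :: real) \<in> borel_measurable (dataset_algebra X n)" if "i < n" for i
    using measurable_compose[OF measurable_compose[OF measurable_nth_dataset[OF that] assms],
        of of_bool borel] by simp
  then have "(\<lambda>D. (\<Sum>i<n. of_bool (c (D ! i))) / real n) \<in> borel_measurable (dataset_algebra X n)"
    by (intro borel_measurable_divide borel_measurable_sum) auto
  moreover have "avg c D = (\<Sum>i<n. of_bool (c (D ! i))) / real n"
    if "D \<in> space (dataset_algebra X n)" for D
    using that by (simp add: avg_def datasets_def sum_list_sum_nth atLeast0LessThan)
  ultimately show ?thesis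
    by (subst measurable_cong) auto
qed

text \<open>Makes accuracy a measurable event of the outputs, so that its complement can enter a
  union bound.\<close>

lemma sets_avg_close:
  assumes "c \<in> measurable X (count_space UNIV)"
  shows "{D' \<in> datasets X n. \<bar>a - avg c D'\<bar> \<le> \<alpha>} \<in> sets (dataset_algebra X n)"
proof -
  note [measurable] = measurable_avg[OF assms]
  have "{D' \<in> space (dataset_algebra X n). \<bar>a - avg c D'\<bar> \<le> \<alpha>} \<in> sets (dataset_algebra X n)"
    by measurable
  then show ?thesis by simp
qed


section \<open>Independent blockwise application of a randomized map\<close>

text \<open>Abstracts from machines. \<open>I\<close> indexes all independent coin sequences, one
  per arrival, and block \<open>b\<close> uses only the one at \<open>p b\<close>; injectivity of
  \<open>p\<close> gives different blocks different coordinates.\<close>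

locale blockwise =
  fixes X :: "'a measure" and n k :: nat and \<Omega> :: "'o measure"
    and hlt :: "'a list \<Rightarrow> 'o \<Rightarrow> bool" and res :: "'a list \<Rightarrow> 'o \<Rightarrow> 'a list"
    and I :: "nat set" and p :: "nat \<Rightarrow> nat"
  assumes rmap: "randomized_map X n \<Omega> hlt res"
    and n_pos: "n > 0" and k_pos: "k > 0"
    and fin_I: "finite I" and inj_p: "inj_on p {..<k}" and p_in: "\<And>b. b < k \<Longrightarrow> p b \<in> I"
begin

abbreviation \<Omega>' :: "(nat \<Rightarrow> 'o) measure" where "\<Omega>' \<equiv> PiM I (\<lambda>_. \<Omega>)"

definition hlt' :: "'a list \<Rightarrow> (nat \<Rightarrow> 'o) \<Rightarrow> bool" where
  "hlt' S \<omega> \<longleftrightarrow> (\<forall>b<k. hlt (block n S b) (\<omega> (p b)))"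

definition res' :: "'a list \<Rightarrow> (nat \<Rightarrow> 'o) \<Rightarrow> 'a list" where
  "res' S \<omega> = concat (map (\<lambda>b. res (block n S b) (\<omega> (p b))) [0..<k])"

sublocale coin: prob_space \<Omega>
  using rmap by (simp add: randomized_map_def)

sublocale prod: product_prob_space "\<lambda>_. \<Omega>" I
  by unfold_locales

lemma
  assumes "D \<in> datasets X n"
  shows AE_hlt: "AE \<omega> in \<Omega>. hlt D \<omega>"
    and res_in: "\<omega> \<in> space \<Omega> \<Longrightarrow> hlt D \<omega> \<Longrightarrow> res D \<omega> \<in> datasets X n"
    and sets_outcome: "T \<in> sets (dataset_algebra X n) \<Longrightarrow> outcome_event \<Omega> hlt res D T \<in> sets \<Omega>"
  using rmap assms by (auto simp: randomized_map_def)

lemma coin_in_space: "\<omega> \<in> space \<Omega>' \<Longrightarrow> b < k \<Longrightarrow> \<omega> (p b) \<in> space \<Omega>"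
  using p_in by (auto simp: space_PiM)

text \<open>Termination is the outcome event of the whole output space, because a halting run
  returns a dataset.\<close>

lemma sets_hlt:
  assumes "D \<in> datasets X n"
  shows "{\<omega> \<in> space \<Omega>. hlt D \<omega>} \<in> sets \<Omega>"
proof -
  have "outcome_event \<Omega> hlt res D (space (dataset_algebra X n)) = {\<omega> \<in> space \<Omega>. hlt D \<omega>}"
    using res_in[OF assms] by (auto simp: outcome_event_def)
  then show ?thesis using sets_outcome[OF assms sets.top] by metis
qed

text \<open>On diverging coins \<open>res\<close> need not be measurable, so there it is replaced by the input.\<close>

lemma measurable_total_res:
  assumes "D \<in> datasets X n"
  shows "(\<lambda>\<omega>. if hlt D \<omega> then res D \<omega> else D) \<in> measurable \<Omega> (dataset_algebra X n)"
proof (rule measurableI)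
  fix T assume T: "T \<in> sets (dataset_algebra X n)"
  have "(\<lambda>\<omega>. if hlt D \<omega> then res D \<omega> else D) -` T \<inter> space \<Omega> =
    outcome_event \<Omega> hlt res D T \<union> (if D \<in> T then space \<Omega> - {\<omega> \<in> space \<Omega>. hlt D \<omega>} else {})"
    by (auto simp: outcome_event_def split: if_splits)
  also have "\<dots> \<in> sets \<Omega>"
    using sets_outcome[OF assms T] sets_hlt[OF assms] by auto
  finally show "(\<lambda>\<omega>. if hlt D \<omega> then res D \<omega> else D) -` T \<inter> space \<Omega> \<in> sets \<Omega>" .
qed (use res_in assms in auto)

lemma res'_in:
  assumes "S \<in> datasets X (k * n)" "\<omega> \<in> space \<Omega>'" "hlt' S \<omega>"
  shows "res' S \<omega> \<in> datasets X (k * n)"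
  unfolding res'_def using assms
  by (intro concat_in_datasets res_in block_in_datasets coin_in_space) (auto simp: hlt'_def)

lemma sets_component:
  assumes "E \<in> sets \<Omega>" "b < k"
  shows "{\<omega> \<in> space \<Omega>'. \<omega> (p b) \<in> E} \<in> sets \<Omega>'"
  using p_in assms by measurable

lemma sets_outcome':
  assumes S: "S \<in> datasets X (k * n)" and T: "T \<in> sets (dataset_algebra X (k * n))"
  shows "outcome_event \<Omega>' hlt' res' S T \<in> sets \<Omega>'"
proof -
  \<comment> \<open>A total version of \<open>res'\<close>, measurable block by block and equal to
    \<open>res'\<close> once all blocks halt; the halting event is intersected separately.\<close>
  define f where "f = (\<lambda>\<omega>. concat (map (\<lambda>b. if hlt (block n S b) (\<omega> (p b))
    then res (block n S b) (\<omega> (p b)) else block n S b) [0..<k]))"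
  have f: "f \<in> measurable \<Omega>' (dataset_algebra X (k * n))"
    unfolding f_def
  proof (rule measurable_concat_dataset)
    fix b assume b: "b < k"
    show "(\<lambda>\<omega>. if hlt (block n S b) (\<omega> (p b)) then res (block n S b) (\<omega> (p b)) else block n S b)
        \<in> measurable \<Omega>' (dataset_algebra X n)"
      by (rule measurable_compose[OF measurable_component_singleton[OF p_in[OF b]]
            measurable_total_res[OF block_in_datasets[OF S b]]])
  qed
  have "outcome_event \<Omega>' hlt' res' S T =
    (f -` T \<inter> space \<Omega>') \<inter>
    (\<Inter>b\<in>{..<k}. {\<omega> \<in> space \<Omega>'. \<omega> (p b) \<in> {x \<in> space \<Omega>. hlt (block n S b) x}})" (is "_ = ?E")
  proof (rule set_eqI)
    fix \<omega>
    have "res' S \<omega> = f \<omega>" if "hlt' S \<omega>"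
      using that unfolding res'_def f_def hlt'_def
      by (intro arg_cong[where f = concat] map_cong) auto
    then show "\<omega> \<in> outcome_event \<Omega>' hlt' res' S T \<longleftrightarrow> \<omega> \<in> ?E"
      using k_pos coin_in_space by (auto simp: outcome_event_def hlt'_def)
  qed
  also have "\<dots> \<in> sets \<Omega>'"
    using k_pos block_in_datasets[OF S]
    by (intro sets.Int measurable_sets[OF f T] sets.finite_INT sets_component sets_hlt) auto
  finally show ?thesis .
qed

lemma randomized_map_blockwise: "randomized_map X (k * n) \<Omega>' hlt' res'"
  unfolding randomized_map_def
proof (intro conjI ballI impI)
  show "prob_space \<Omega>'" by (rule prod.prob_space_axioms)
  fix S assume S: "S \<in> datasets X (k * n)"
  have "AE \<omega> in \<Omega>'. \<forall>b\<in>{..<k}. hlt (block n S b) (\<omega> (p b))"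
    using block_in_datasets[OF S] p_in
    by (intro AE_finite_allI prod.AE_component AE_hlt) auto
  then show "AE \<omega> in \<Omega>'. hlt' S \<omega>" by (simp add: hlt'_def Ball_def)
qed (use res'_in sets_outcome' in auto)

section \<open>Privacy through sections of the coin space\<close>

text \<open>Tonelli for the split into coordinate \<open>i\<close> and the rest; it allows one coin
  sequence to vary while the others are frozen.\<close>

lemma emeasure_outcome':
  assumes S: "S \<in> datasets X (k * n)" and T: "T \<in> sets (dataset_algebra X (k * n))" and i: "i \<in> I"
  shows "emeasure \<Omega>' (outcome_event \<Omega>' hlt' res' S T) =
    (\<integral>\<^sup>+ \<eta>. emeasure \<Omega> {x \<in> space \<Omega>. \<eta>(i := x) \<in> outcome_event \<Omega>' hlt' res' S T}
      \<partial>PiM (I - {i}) (\<lambda>_. \<Omega>))"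
proof -
  let ?E = "outcome_event \<Omega>' hlt' res' S T"
  have E: "?E \<in> sets \<Omega>'" by (rule sets_outcome'[OF S T])
  have "emeasure \<Omega>' ?E = (\<integral>\<^sup>+ \<omega>. indicator ?E \<omega> \<partial>\<Omega>')" using E by simp
  also have "\<dots> = (\<integral>\<^sup>+ \<eta>. (\<integral>\<^sup>+ x. indicator ?E (\<eta>(i := x)) \<partial>\<Omega>) \<partial>PiM (I - {i}) (\<lambda>_. \<Omega>))"
    using prod.product_nn_integral_insert[of "I - {i}" i "indicator ?E"] fin_I E
    by (simp add: insert_absorb[OF i])
  also have "\<dots> = (\<integral>\<^sup>+ \<eta>. emeasure \<Omega> {x \<in> space \<Omega>. \<eta>(i := x) \<in> ?E} \<partial>PiM (I - {i}) (\<lambda>_. \<Omega>))"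
  proof (rule nn_integral_cong)
    fix \<eta> assume "\<eta> \<in> space (PiM (I - {i}) (\<lambda>_. \<Omega>))"
    then have "(\<lambda>x. \<eta>(i := x)) \<in> measurable \<Omega> \<Omega>'"
      using measurable_component_update[of \<eta> "I - {i}" "\<lambda>_. \<Omega>" i]
      by (simp add: insert_absorb[OF i])
    from measurable_sets[OF this E]
    have "{x \<in> space \<Omega>. \<eta>(i := x) \<in> ?E} \<in> sets \<Omega>"
      by (simp add: vimage_def Int_def conj_commute)
    moreover have "(\<integral>\<^sup>+ x. indicator ?E (\<eta>(i := x)) \<partial>\<Omega>) =
        (\<integral>\<^sup>+ x. indicator {x \<in> space \<Omega>. \<eta>(i := x) \<in> ?E} x \<partial>\<Omega>)"
      by (intro nn_integral_cong) (simp add: indicator_def)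
    ultimately show "(\<integral>\<^sup>+ x. indicator ?E (\<eta>(i := x)) \<partial>\<Omega>) =
        emeasure \<Omega> {x \<in> space \<Omega>. \<eta>(i := x) \<in> ?E}"
      by simp
  qed
  finally show ?thesis .
qed

text \<open>Frozen coins make the other outputs constant, so what remains is one run on block
  \<open>b\<close> whose result is inserted among these constants. If a frozen run diverges, no
  coins at \<open>p b\<close> make the whole computation halt.\<close>

lemma section_outcome':
  assumes S: "S \<in> datasets X (k * n)" and b: "b < k"
    and \<eta>: "\<eta> \<in> space (PiM (I - {p b}) (\<lambda>_. \<Omega>))"
  shows "{x \<in> space \<Omega>. \<eta>(p b := x) \<in> outcome_event \<Omega>' hlt' res' S T} =
    (if \<forall>b'<k. b' \<noteq> b \<longrightarrow> hlt (block n S b') (\<eta> (p b'))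
     then outcome_event \<Omega> hlt res (block n S b)
       {y \<in> datasets X n.
         concat (map (\<lambda>b'. if b' = b then y else res (block n S b') (\<eta> (p b'))) [0..<k]) \<in> T}
     else {})"
proof -
  \<comment> \<open>By injectivity of \<open>p\<close>, the update at \<open>p b\<close> reaches
    block \<open>b\<close> only.\<close>
  have p: "p b' = p b \<longleftrightarrow> b' = b" if "b' < k" for b'
    using inj_p b that by (auto simp: inj_on_def)
  have space: "\<eta>(p b := x) \<in> space \<Omega>' \<longleftrightarrow> x \<in> space \<Omega>" for x
    using \<eta> p_in[OF b] by (auto simp: space_PiM PiE_iff extensional_def)
  have hlt: "hlt' S (\<eta>(p b := x)) \<longleftrightarrow>
      hlt (block n S b) x \<and> (\<forall>b'<k. b' \<noteq> b \<longrightarrow> hlt (block n S b') (\<eta> (p b')))" for x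
    using b by (auto simp: hlt'_def p)
  have res: "res' S (\<eta>(p b := x)) =
      concat (map (\<lambda>b'. if b' = b then res (block n S b) x else res (block n S b') (\<eta> (p b'))) [0..<k])"
    for x
    unfolding res'_def by (intro arg_cong[where f = concat] map_cong) (auto simp: p)
  show ?thesis
    using res_in[OF block_in_datasets[OF S b]]
    by (auto simp: outcome_event_def space hlt res)
qed

text \<open>Parallel composition: disjoint parts of the input are processed with independent
  coins.\<close>

lemma differentially_private_blockwise:
  assumes dp: "differentially_private X n \<epsilon> \<delta> \<Omega> hlt res" and "\<delta> \<ge> 0"
  shows "differentially_private X (k * n) \<epsilon> \<delta> \<Omega>' hlt' res'"
  unfolding differentially_private_def
proof (intro ballI impI)
  fix S S' T
  assume S: "S \<in> datasets X (k * n)" and S': "S' \<in> datasets X (k * n)"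
    and nb: "neighboring S S'" and T: "T \<in> sets (dataset_algebra X (k * n))"
  obtain b where b: "b < k" and nb': "neighboring (block n S b) (block n S' b)"
    and same: "\<And>b'. b' < k \<Longrightarrow> b' \<noteq> b \<Longrightarrow> block n S b' = block n S' b'"
    using neighboring_blocks[OF nb] S by (auto simp: datasets_def)
  let ?E = "\<lambda>S. outcome_event \<Omega>' hlt' res' S T"
  let ?sec = "\<lambda>S \<eta>. {x \<in> space \<Omega>. \<eta>(p b := x) \<in> ?E S}"
  let ?P = "PiM (I - {p b}) (\<lambda>_. \<Omega>)"
  interpret rest: prob_space ?P by (intro prob_space_PiM coin.prob_space_axioms)
  have sec: "emeasure \<Omega> (?sec S \<eta>) \<le> ennreal (exp \<epsilon>) * emeasure \<Omega> (?sec S' \<eta>) + ennreal \<delta>"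
    if \<eta>: "\<eta> \<in> space ?P" for \<eta>
  proof (cases "\<forall>b'<k. b' \<noteq> b \<longrightarrow> hlt (block n S b') (\<eta> (p b'))")
    case True
    define U where "U = {y \<in> datasets X n.
      concat (map (\<lambda>b'. if b' = b then y else res (block n S b') (\<eta> (p b'))) [0..<k]) \<in> T}"
    have other: "res (block n S b') (\<eta> (p b')) \<in> datasets X n" if "b' < k" "b' \<noteq> b" for b'
    proof (intro res_in block_in_datasets[OF S])
      have "p b' \<noteq> p b" using inj_p b that by (auto simp: inj_on_def)
      then show "\<eta> (p b') \<in> space \<Omega>"
        using \<eta> p_in[OF that(1)] by (auto simp: space_PiM)
    qed (use True that in auto)
    have "(\<lambda>y. concat (map (\<lambda>b'. if b' = b then y else res (block n S b') (\<eta> (p b'))) [0..<k]))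
        \<in> measurable (dataset_algebra X n) (dataset_algebra X (k * n))"
    proof (rule measurable_concat_dataset)
      fix b' assume "b' < k"
      then show "(\<lambda>y. if b' = b then y else res (block n S b') (\<eta> (p b')))
          \<in> measurable (dataset_algebra X n) (dataset_algebra X n)"
        using other by (cases "b' = b") auto
    qed
    from measurable_sets[OF this T] have U: "U \<in> sets (dataset_algebra X n)"
      by (simp add: U_def vimage_def Int_def conj_commute)
    have "map (\<lambda>b'. if b' = b then y else res (block n S b') (\<eta> (p b'))) [0..<k] =
        map (\<lambda>b'. if b' = b then y else res (block n S' b') (\<eta> (p b'))) [0..<k]" for y
      using same by (intro map_cong) auto
    then have "U = {y \<in> datasets X n.
        concat (map (\<lambda>b'. if b' = b then y else res (block n S' b') (\<eta> (p b'))) [0..<k]) \<in> T}"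
      unfolding U_def by metis
    then have "?sec S \<eta> = outcome_event \<Omega> hlt res (block n S b) U"
      "?sec S' \<eta> = outcome_event \<Omega> hlt res (block n S' b) U"
      using True same
      by (simp_all add: section_outcome'[OF S b \<eta>] section_outcome'[OF S' b \<eta>] U_def[symmetric])
    moreover have "measure \<Omega> (outcome_event \<Omega> hlt res (block n S b) U)
        \<le> exp \<epsilon> * measure \<Omega> (outcome_event \<Omega> hlt res (block n S' b) U) + \<delta>"
      using dp nb' U block_in_datasets[OF S b] block_in_datasets[OF S' b]
      by (auto simp: differentially_private_def)
    ultimately show ?thesis
      using \<open>\<delta> \<ge> 0\<close>
      by (simp add: coin.emeasure_eq_measure ennreal_mult'[symmetric] ennreal_plus[symmetric]
          del: ennreal_plus)
  next
    case False
    \<comment> \<open>A frozen block diverges, so the left-hand side is 0.\<close>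
    then have "?sec S \<eta> = {}"
      unfolding section_outcome'[OF S b \<eta>] by (rule if_not_P)
    then show ?thesis by (simp only: emeasure_empty zero_le)
  qed
  \<comment> \<open>Joint measurability of the update makes the section probability measurable in
    \<eta>, which permits splitting the integral.\<close>
  have "(\<lambda>(\<eta>, x). \<eta>(p b := x)) \<in> measurable (?P \<Otimes>\<^sub>M \<Omega>) \<Omega>'"
    using measurable_add_dim[of "p b" "I - {p b}" "\<lambda>_. \<Omega>"]
    by (simp add: insert_absorb[OF p_in[OF b]])
  from measurable_sets[OF this sets_outcome'[OF S' T]]
  have "{z \<in> space (?P \<Otimes>\<^sub>M \<Omega>). snd z \<in> ?sec S' (fst z)} \<in> sets (?P \<Otimes>\<^sub>M \<Omega>)"
    by (rule back_subst[of "\<lambda>U. U \<in> _"]) (auto simp: space_pair_measure)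
  then have meas: "(\<lambda>\<eta>. emeasure \<Omega> (?sec S' \<eta>)) \<in> borel_measurable ?P"
    by (intro coin.measurable_emeasure) auto
  have "emeasure \<Omega>' (?E S) = (\<integral>\<^sup>+ \<eta>. emeasure \<Omega> (?sec S \<eta>) \<partial>?P)"
    by (rule emeasure_outcome'[OF S T p_in[OF b]])
  also have "\<dots> \<le> (\<integral>\<^sup>+ \<eta>. ennreal (exp \<epsilon>) * emeasure \<Omega> (?sec S' \<eta>) + ennreal \<delta> \<partial>?P)"
    by (rule nn_integral_mono) (rule sec)
  also have "\<dots> = ennreal (exp \<epsilon>) * emeasure \<Omega>' (?E S') + ennreal \<delta>"
    using meas
    by (simp add: nn_integral_add nn_integral_cmult rest.emeasure_space_1
        emeasure_outcome'[OF S' T p_in[OF b]])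
  finally show "measure \<Omega>' (?E S) \<le> exp \<epsilon> * measure \<Omega>' (?E S') + \<delta>"
    using \<open>\<delta> \<ge> 0\<close>
    by (simp add: prod.emeasure_eq_measure ennreal_mult'[symmetric] ennreal_plus[symmetric]
        del: ennreal_plus)
qed

section \<open>Accuracy through a union bound\<close>

lemma accurate_blockwise:
  assumes acc: "accurate X C n \<alpha> \<beta> \<Omega> hlt res"
    and C: "\<And>c. c \<in> C \<Longrightarrow> c \<in> measurable X (count_space UNIV)"
  shows "accurate X C (k * n) \<alpha> (real k * \<beta>) \<Omega>' hlt' res'"
  unfolding accurate_def
proof (intro ballI)
  fix S c assume S: "S \<in> datasets X (k * n)" and c: "c \<in> C"
  define good where "good b = outcome_event \<Omega> hlt res (block n S b)
    {D' \<in> datasets X n. \<bar>avg c (block n S b) - avg c D'\<bar> \<le> \<alpha>}" for b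
  define G where "G b = {\<omega> \<in> space \<Omega>'. \<omega> (p b) \<in> good b}" for b
  define E where "E = outcome_event \<Omega>' hlt' res' S
    {S' \<in> datasets X (k * n). \<bar>avg c S - avg c S'\<bar> \<le> \<alpha>}"
  have good: "good b \<in> sets \<Omega>" if "b < k" for b
    unfolding good_def
    using block_in_datasets[OF S that] sets_avg_close[OF C[OF c]] by (intro sets_outcome)
  have G: "G b \<in> sets \<Omega>'" if "b < k" for b
    unfolding G_def by (rule sets_component[OF good[OF that] that])
  have E: "E \<in> sets \<Omega>'"
    unfolding E_def using S sets_avg_close[OF C[OF c]] by (intro sets_outcome')
  have bad: "measure \<Omega>' (space \<Omega>' - G b) \<le> \<beta>" if b: "b < k" for b
  proof -
    \<comment> \<open>Every coordinate of the product has law \<Omega>, so the cylinder has the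
      probability of its base.\<close>
    have "measure \<Omega>' (G b) = measure \<Omega> (good b)"
      using prod.emeasure_PiM_Collect_single[OF p_in[OF b] good[OF b]]
      by (simp add: G_def measure_def)
    moreover have "measure \<Omega> (good b) \<ge> 1 - \<beta>"
      using acc c block_in_datasets[OF S b] by (simp add: accurate_def good_def)
    ultimately show ?thesis using prod.prob_compl[OF G[OF b]] by simp
  qed
  \<comment> \<open>If no block fails, every block halts with error at most \<alpha>, and averaging
    keeps this bound.\<close>
  have "space \<Omega>' - E \<subseteq> (\<Union>b\<in>{..<k}. space \<Omega>' - G b)"
  proof (rule subsetI, rule ccontr)
    fix \<omega> assume \<omega>: "\<omega> \<in> space \<Omega>' - E" "\<omega> \<notin> (\<Union>b\<in>{..<k}. space \<Omega>' - G b)"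
    then have block: "hlt (block n S b) (\<omega> (p b)) \<and> res (block n S b) (\<omega> (p b)) \<in> datasets X n \<and>
        \<bar>avg c (block n S b) - avg c (res (block n S b) (\<omega> (p b)))\<bar> \<le> \<alpha>" if "b < k" for b
      using that by (auto simp: G_def good_def outcome_event_def)
    have h: "hlt' S \<omega>" using block by (simp add: hlt'_def)
    have len: "length S = k * n" using S by (simp add: datasets_def)
    have "\<bar>avg c (concat (map (block n S) [0..<k])) - avg c (res' S \<omega>)\<bar> \<le> \<alpha>"
      unfolding res'_def using block n_pos k_pos length_block[OF len]
      by (intro avg_concat_close[where n = n]) (auto simp: datasets_def)
    then have "\<omega> \<in> E"
      using \<omega> h res'_in[OF S] by (simp add: E_def outcome_event_def concat_blocks[OF len])
    then show False using \<omega> by simp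
  qed
  then have "measure \<Omega>' (space \<Omega>' - E) \<le> measure \<Omega>' (\<Union>b\<in>{..<k}. space \<Omega>' - G b)"
    using G by (intro prod.finite_measure_mono sets.finite_UN) auto
  also have "\<dots> \<le> (\<Sum>b\<in>{..<k}. measure \<Omega>' (space \<Omega>' - G b))"
    using G by (intro prod.finite_measure_subadditive_finite) auto
  also have "\<dots> \<le> real k * \<beta>"
    using sum_bounded_above[of "{..<k}" "\<lambda>b. measure \<Omega>' (space \<Omega>' - G b)" \<beta>] bad by simp
  finally show "measure \<Omega>' E \<ge> 1 - real k * \<beta>"
    using prod.prob_compl[OF E] by simp
qed

end


section \<open>The streaming sanitizer\<close>

text \<open>The three properties inspect results only on halting coins, so agreement of the results
  is required only there.\<close>

lemma randomized_map_props_cong: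
  assumes "\<And>S \<omega>. S \<in> datasets X m \<Longrightarrow> hlt S \<omega> \<longleftrightarrow> hlt' S \<omega>"
    and "\<And>S \<omega>. S \<in> datasets X m \<Longrightarrow> hlt' S \<omega> \<Longrightarrow> res S \<omega> = res' S \<omega>"
  shows "randomized_map X m \<Omega> hlt res \<longleftrightarrow> randomized_map X m \<Omega> hlt' res'"
    and "differentially_private X m \<epsilon> \<delta> \<Omega> hlt res \<longleftrightarrow> differentially_private X m \<epsilon> \<delta> \<Omega> hlt' res'"
    and "accurate X C m \<alpha> \<beta> \<Omega> hlt res \<longleftrightarrow> accurate X C m \<alpha> \<beta> \<Omega> hlt' res'"
proof -
  have event: "outcome_event \<Omega> hlt res S T = outcome_event \<Omega> hlt' res' S T"
    if "S \<in> datasets X m" for S T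
    using assms that by (auto simp: outcome_event_def)
  show "randomized_map X m \<Omega> hlt res \<longleftrightarrow> randomized_map X m \<Omega> hlt' res'"
    using assms by (auto simp: randomized_map_def event)
  show "differentially_private X m \<epsilon> \<delta> \<Omega> hlt res \<longleftrightarrow> differentially_private X m \<epsilon> \<delta> \<Omega> hlt' res'"
    by (simp add: differentially_private_def event cong: ball_cong)
  show "accurate X C m \<alpha> \<beta> \<Omega> hlt res \<longleftrightarrow> accurate X C m \<alpha> \<beta> \<Omega> hlt' res'"
    by (simp add: accurate_def event cong: ball_cong)
qed

text \<open>Almost sure halting provides some halting coins, hence a final state. Starting in a
  final state would give empty output, whereas a dataset of length \<open>n > 0\<close> is due. The
  witness \<open>D\<close> rules out an empty data domain, over which the sanitizer conditions on
  inputs are vacuous.\<close>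

lemma sanitizer_final_states:
  assumes "sanitizer X C \<alpha> \<beta> \<epsilon> \<delta> n A" and "D \<in> datasets X n" and "n > 0"
  shows "final A \<noteq> {}" and "start A \<notin> final A"
proof -
  have rmap: "randomized_map X n (tape A) (\<lambda>D \<omega>. halts A \<omega> (layout A D))
      (\<lambda>D \<omega>. snd (run_result A \<omega> (layout A D)))"
    using assms(1) by (simp add: sanitizer_def Let_def)
  then interpret prob_space "tape A" by (simp add: randomized_map_def)
  obtain \<omega> where \<omega>: "\<omega> \<in> space (tape A)" "halts A \<omega> (layout A D)"
  proof (rule ccontr)
    assume "\<not> thesis"
    then have "AE \<omega> in tape A. \<not> halts A \<omega> (layout A D)" using that by (intro AE_I2) blast
    moreover have "AE \<omega> in tape A. halts A \<omega> (layout A D)"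
      using rmap assms(2) by (simp add: randomized_map_def)
    ultimately have "AE \<omega> in tape A. False" by eventually_elim simp
    then show False by simp
  qed
  then show "final A \<noteq> {}" by (auto simp: halts_def final_at_def)
  have "snd (run_result A \<omega> (layout A D)) \<in> datasets X n"
    using rmap assms(2) \<omega> by (simp add: randomized_map_def)
  then have "snd (run_result A \<omega> (layout A D)) \<noteq> []"
    using \<open>n > 0\<close> by (auto simp: datasets_def)
  moreover have "snd (run_result A \<omega> (layout A D)) = []" if "start A \<in> final A"
  proof -
    have "final_at A \<omega> (layout A D) 0" using that by (simp add: final_at_def)
    then have "(LEAST t. final_at A \<omega> (layout A D) t) = 0" by (rule Least_eq_0)
    then show ?thesis by (simp add: run_result_def)
  qed
  ultimately show "start A \<notin> final A" by blast
qed

text \<open>A maximum and not a sum: the first step on a full buffer replaces it by a configuration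
  of \<open>A\<close>, so the two never coexist.\<close>

lemma streaming_space_stream_machine:
  assumes san: "sanitizer X C \<alpha> \<beta> \<epsilon> \<delta> n A" and n: "n > 0"
  shows "streaming_space X (stream_machine n A) (k * n) \<le> max (of_nat n) (offline_space X A n)"
  unfolding streaming_space_def
proof (intro SUP_least)
  let ?B = "stream_machine n A"
  fix S \<omega> i t
  assume S: "S \<in> datasets X (k * n)" and \<omega>: "\<omega> \<in> space (online_tape ?B (k * n))"
    and "i \<in> {i. i < k * n \<and> online_halts ?B \<omega> S i}"
  then have i: "i < k * n" and halted: "online_halts ?B \<omega> S i" by auto
  define b where "b = i div n"
  have b: "b < k" using i by (simp add: b_def less_mult_imp_div_less)
  have D: "block n S b \<in> datasets X n" by (rule block_in_datasets[OF S b])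
  note fin = sanitizer_final_states[OF san D n]
  have len: "length S = k * n" using S by (simp add: datasets_def)
  \<comment> \<open>Only arrivals preceded by halting invocations are counted, and for these the
    memory is known.\<close>
  have mem: "fst (online_run ?B \<omega> S i) = map Item (take (i mod n) (block n S b))"
    using online_stream_machine[OF n fin len, of i \<omega>] i halted n
    by (simp add: b_def block_def min_absorb1 less_imp_le)
  have in_block: "block n S b ! (i mod n) = S ! i"
    using nth_block[OF len b, of "i mod n"] n by (simp add: b_def)
  have arr: "arrival_mem ?B \<omega> S i = map Item (take (Suc (i mod n)) (block n S b))"
    using n length_block[OF len b]
    by (simp add: arrival_mem_def mem in_block take_Suc_conv_app_nth)
  have lenD: "length (block n S b) = n" by (rule length_block[OF len b])
  show "of_nat (length (mem_at ?B (\<omega> i) (arrival_mem ?B \<omega> S i) t))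
      \<le> max (of_nat n) (offline_space X A n)"
  proof (cases "Suc (i mod n) = n")
    case False
    then have "Suc (i mod n) < n" using n by (metis Suc_lessI mod_less_divisor)
    then have "length (arrival_mem ?B \<omega> S i) < n"
      using lenD by (simp add: arr)
    moreover from this have "mem_at ?B (\<omega> i) (arrival_mem ?B \<omega> S i) t = arrival_mem ?B \<omega> S i"
      using fin(1) by (rule mem_at_buffering)
    ultimately show ?thesis
      by (simp add: le_max_iff_disj)
  next
    case True
    \<comment> \<open>The coins of this invocation form an admissible tape of \<open>A\<close>, so
      the simulated run is among those in the supremum.\<close>
    have "\<omega> i \<in> space (tape A)"
      using \<omega> i by (auto simp: online_tape_def space_PiM)
    then have offline: "of_nat (length (mem_at A (\<omega> i) (layout A (block n S b)) t)) \<le> offline_space X A n"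
      unfolding offline_space_def
      by (intro SUP_upper2[OF D] SUP_upper2[of "\<omega> i"] SUP_upper UNIV_I)
    have full: "arrival_mem ?B \<omega> S i = map Item (block n S b)"
      unfolding arr True using lenD by simp
    have "length (mem_at ?B (\<omega> i) (arrival_mem ?B \<omega> S i) t) \<le> n \<or>
        length (mem_at ?B (\<omega> i) (arrival_mem ?B \<omega> S i) t)
          \<le> length (mem_at A (\<omega> i) (layout A (block n S b)) t)"
      unfolding full
      using length_mem_at_full[OF lenD fin(2), of "\<omega> i" t] by (simp only: le_max_iff_disj)
    then show ?thesis
    proof
      assume "length (mem_at ?B (\<omega> i) (arrival_mem ?B \<omega> S i) t) \<le> n"
      from of_nat_mono[OF this] show ?thesis unfolding le_max_iff_disj by (rule disjI1)
    next
      assume "length (mem_at ?B (\<omega> i) (arrival_mem ?B \<omega> S i) t)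
          \<le> length (mem_at A (\<omega> i) (layout A (block n S b)) t)"
      from order.trans[OF of_nat_mono[OF this] offline]
      show ?thesis unfolding le_max_iff_disj by (rule disjI2)
    qed
  qed
qed

text \<open>The constant \<open>r\<close> expresses that the space is at least linear in
  \<open>n\<close>, and space is compared up to the factor \<open>max 1 (1 / r)\<close>. The machine
  \<open>B\<close> keeps the coin and word types of \<open>A\<close>, and its control type is again
  finite.\<close>

theorem theorem2p1:
  fixes X :: "'a measure" and C :: "('a \<Rightarrow> bool) set"
    and A :: "('r, 'q::finite, 'a, 'w) offline"
    and \<alpha> \<beta> \<epsilon> \<delta> r :: real and n k m :: nat
  assumes "\<And>c. c \<in> C \<Longrightarrow> c \<in> measurable X (count_space UNIV)"
    and "\<alpha> \<in> {0..1}" and "\<beta> \<in> {0..1}" and "\<epsilon> \<ge> 0" and "\<delta> \<in> {0..1}" and "n > 0"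
    and "sanitizer X C \<alpha> \<beta> \<epsilon> \<delta> n A"
    and "r > 0" and "ennreal (r * real n) \<le> offline_space X A n"
    and "k > 0" and "m = k * n"
  shows "\<exists>B :: ('r, 'q option, 'a, 'w) machine.
           streaming_sanitizer X C \<alpha> (real k * \<beta>) \<epsilon> \<delta> m B \<and>
           streaming_space X B m \<le> ennreal (max 1 (1 / r)) * offline_space X A n"
proof (intro exI conjI)
  let ?B = "stream_machine n A"
  define hlt where "hlt = (\<lambda>D \<omega>. halts A \<omega> (layout A D))"
  define res where "res = (\<lambda>D \<omega>. snd (run_result A \<omega> (layout A D)))"
  \<comment> \<open>The last arrival of block \<open>b\<close>, counted from 0: the one whose coins
    drive the run of \<open>A\<close> on that block.\<close>
  define p where "p = (\<lambda>b. b * n + (n - 1))"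
  have san: "prob_space (coins A)" "randomized_map X n (tape A) hlt res"
    "differentially_private X n \<epsilon> \<delta> (tape A) hlt res" "accurate X C n \<alpha> \<beta> (tape A) hlt res"
    using assms(7) by (simp_all add: sanitizer_def hlt_def res_def Let_def)
  interpret blockwise X n k "tape A" hlt res "{..<m}" p
  proof
    show "inj_on p {..<k}" using \<open>n > 0\<close>
      by (auto intro!: inj_onI simp only: p_def add_right_cancel mult_cancel2)
    show "p b \<in> {..<m}" if "b < k" for b
      using block_index_less[OF that, of "n - 1" n] \<open>n > 0\<close> by (simp add: p_def \<open>m = k * n\<close>)
  qed (use san assms in auto)
  have online: "(online_halts ?B \<omega> S m \<longleftrightarrow> hlt' S \<omega>) \<and>
      (hlt' S \<omega> \<longrightarrow> snd (online_run ?B \<omega> S m) = res' S \<omega>)" if "S \<in> datasets X m" for S \<omega>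
  proof -
    \<comment> \<open>Block 0 exists since \<open>k > 0\<close> and serves as the witness that the
      data domain is nonempty.\<close>
    have "block n S 0 \<in> datasets X n"
      using that \<open>k > 0\<close> by (intro block_in_datasets[of _ X k]) (simp_all add: \<open>m = k * n\<close>)
    note fin = sanitizer_final_states[OF assms(7) this \<open>n > 0\<close>]
    have "length S = k * n" using that by (simp add: datasets_def \<open>m = k * n\<close>)
    note run = online_stream_machine[OF \<open>n > 0\<close> fin this order.refl, of \<omega>]
    have kn: "k * n div n = k" using \<open>n > 0\<close> by simp
    have "online_halts ?B \<omega> S (k * n) \<longleftrightarrow> hlt' S \<omega>"
      using run[THEN conjunct1] unfolding hlt'_def unfolding hlt_def p_def kn .
    moreover have "snd (online_run ?B \<omega> S (k * n)) = res' S \<omega>" if "online_halts ?B \<omega> S (k * n)"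
      using run[THEN conjunct2, rule_format, OF that]
      unfolding res'_def unfolding res_def p_def by (simp only: kn snd_conv)
    ultimately show ?thesis unfolding \<open>m = k * n\<close> by blast
  qed
  have tape: "online_tape ?B m = \<Omega>'" by (simp add: online_tape_def)
  note transfer = randomized_map_props_cong[where hlt = "\<lambda>S \<omega>. online_halts ?B \<omega> S m"
      and res = "\<lambda>S \<omega>. snd (online_run ?B \<omega> S m)" and hlt' = hlt' and res' = res' and X = X and m = m,
      OF online[THEN conjunct1] online[THEN conjunct2, rule_format], THEN iffD2]
  show "streaming_sanitizer X C \<alpha> (real k * \<beta>) \<epsilon> \<delta> m ?B"
    unfolding streaming_sanitizer_def Let_def tape
  proof (intro conjI transfer)
    show "prob_space (coins ?B)" using san(1) by simp
    show "randomized_map X m \<Omega>' hlt' res'"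
      using randomized_map_blockwise by (simp only: \<open>m = k * n\<close>)
    show "differentially_private X m \<epsilon> \<delta> \<Omega>' hlt' res'"
      using differentially_private_blockwise[OF san(3)] assms(5)
      by (simp only: \<open>m = k * n\<close> atLeastAtMost_iff)
    show "accurate X C m \<alpha> (real k * \<beta>) \<Omega>' hlt' res'"
      using accurate_blockwise[OF san(4) assms(1)] by (simp only: \<open>m = k * n\<close>)
  qed
  \<comment> \<open>The linear lower bound pays for the buffer at the price of the factor
    \<open>1 / r\<close>.\<close>
  have "(of_nat n :: ennreal) = ennreal (1 / r) * ennreal (r * real n)"
    using \<open>r > 0\<close> by (simp add: ennreal_mult'[symmetric] ennreal_of_nat_eq_real_of_nat)
  also have "\<dots> \<le> ennreal (max 1 (1 / r)) * offline_space X A n"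
    using assms(9) by (intro mult_mono ennreal_leI) auto
  finally have "of_nat n \<le> ennreal (max 1 (1 / r)) * offline_space X A n" .
  \<comment> \<open>The memory of \<open>A\<close> itself requires a factor of at least 1, hence the
    maximum.\<close>
  moreover have "ennreal 1 * offline_space X A n \<le> ennreal (max 1 (1 / r)) * offline_space X A n"
    by (intro mult_right_mono ennreal_leI) auto
  ultimately have "max (of_nat n) (offline_space X A n)
      \<le> ennreal (max 1 (1 / r)) * offline_space X A n"
    by simp
  then show "streaming_space X ?B m \<le> ennreal (max 1 (1 / r)) * offline_space X A n"
    using streaming_space_stream_machine[OF assms(7) \<open>n > 0\<close>, of k]
    unfolding \<open>m = k * n\<close> by (rule order.trans[rotated])
qed

end
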